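(* Let $A\in\mathbb{R}^{n\times n}$, $C\in\mathbb{R}^{q\times n}$, $F\in\mathbb{R}^{r\times n}$. If $$\operatorname{rank}\begin{pmatrix}C\\ F\end{pmatrix}=\operatorname{rank}(C),$$ then using a sampling scheme $\{t_i\}_{i=1}^k$ such that $$\operatorname{rank}\big(O_{\mathrm s}(A_{\mathrm{ob,F}},F_{\mathrm{ob}})\big)=n-p_F$$ guarantees sample-based functional observability of $(A,C,F)$ (for that sampling scheme). (The statement holds both in the continuous-time and in the discrete-time setting, with the corresponding sample-based observability matrix $O_{\mathrm s}$.)
   Context: System: $x^+=Ax(t)+Bu(t)$, $y(t)=Cx(t)+Du(t)$, $z(t)=Fx(t)$ with $A\in\mathbb{R}^{n\times n}$, $B\in\mathbb{R}^{n\times m}$, $C\in\mathbb{R}^{q\times n}$, $D\in\mathbb{R}^{q\times m}$, $F\in\mathbb{R}^{r\times n}$, where $x^+$ denotes $\dot x(t)$ for continuous-time systems and $x(t+1)$ for discrete-time systems. Observability matrix: for $M\in\mathbb{R}^{n\times n}$ and $N$ with $n$ columns, $O(M,N)$ is the matrix obtained by stacking $N, NM, NM^2,\dots,NM^{n-1}$ vertically. Sampling scheme: time instances $\{t_i\}_{i=1}^k$, $k\ge 1$, with $0\le t_1$ and $t_i<t_{i+1}$ for $i=1,\dots,k-1$ (real numbers in continuous time, integers in discrete time). Sample-based observability matrix: for a pair $(M,N)$, $O_{\mathrm s}(M,N)$ is the matrix obtained by stacking vertically $Ne^{Mt_1},\dots,Ne^{Mt_k}$ in the continuous-time case, and $NM^{t_1},\dots,NM^{t_k}$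 in the discrete-time case. Observable subsystem of $(A,F)$ and the constant $\sigma$: let $p_F$ be the dimension of the unobservable subspace $\operatorname{null}(O(A,F))$ of $(A,F)$. There is an invertible $P_{\mathrm{o,F}}\in\mathbb{R}^{n\times n}$ with $$P_{\mathrm{o,F}}^{-1}AP_{\mathrm{o,F}}=\begin{pmatrix}A_{\mathrm{ob,F}}&0\\ A_{21,\mathrm F}&A_{\overline{\mathrm{ob}},\mathrm F}\end{pmatrix},\qquad FP_{\mathrm{o,F}}=\begin{pmatrix}F_{\mathrm{ob}}&0\end{pmatrix},$$ where $(A_{\mathrm{ob,F}},F_{\mathrm{ob}})$ is observable of order $n-p_F$. Let $\nu$ be the observability index of $(A_{\mathrm{ob,F}},F_{\mathrm{ob}})$, i.e. the smallest integer such that the matrix obtained by stacking $F_{\mathrm{ob}},F_{\mathrm{ob}}A_{\mathrm{ob,F}},\dots,F_{\mathrm{ob}}A_{\mathrm{ob,F}}^{\nu-1}$ has rank $n-p_F$. Set $\sigma=0$ if the system is continuous-time and $\sigma=\nu-2$ if it is discrete-time. Sample-based functional observability: $(A,C,F)$ is sample-based functionally observable for the sampling sequence $\{t_i\}_{i=1}^k$ if there exists a finite time $\bar t>\sigma$ such that for any initial state $x_0$ and input $u(t)$, the value of $Fx(t)$, $0\le t\le\bar t$, can be uniquely reconstructed from the knowledge of the input trajectory on the interval $[0,\bar t]$ and the sampled outputs $y(t_i)$, $i=1,\dots,k$. (In discrete time, times are integers.) *)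

theory Defs
  imports
    "HOL-Analysis.Henstock_Kurzweil_Integration"
    "Jordan_Normal_Form.Matrix_Kernel"
    "Jordan_Normal_Form.DL_Rank"
begin

text \<open>
  Matrices and vectors are those of \<^theory>\<open>Jordan_Normal_Form.Matrix\<close>, since the observable
  subsystem has an order that depends on the data and may be \<open>0\<close>.
\<close>

abbreviation mat_rank :: "real mat \<Rightarrow> nat" where
  "mat_rank M \<equiv> vec_space.rank (dim_row M) M"

text \<open>The column count is an argument because the list of blocks may be empty.\<close>

definition stack_rows :: "nat \<Rightarrow> real mat list \<Rightarrow> real mat" where
  "stack_rows nc Ms = foldr append_rows Ms (0\<^sub>m 0 nc)"

definition mat_exp :: "real mat \<Rightarrow> real mat" where
  "mat_exp M = mat (dim_row M) (dim_row M)
     (\<lambda>(i, j). \<Sum>k. (M ^\<^sub>m k) $$ (i, j) / fact k)"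


subsection \<open>Observability\<close>

definition partial_obs_matrix :: "nat \<Rightarrow> real mat \<Rightarrow> real mat \<Rightarrow> real mat" where
  "partial_obs_matrix l M N = stack_rows (dim_col N) (map (\<lambda>j. N * M ^\<^sub>m j) [0..<l])"

definition obs_matrix :: "real mat \<Rightarrow> real mat \<Rightarrow> real mat" where
  "obs_matrix M N = partial_obs_matrix (dim_row M) M N"

definition observable :: "real mat \<Rightarrow> real mat \<Rightarrow> bool" where
  "observable M N \<longleftrightarrow> mat_rank (obs_matrix M N) = dim_row M"

text \<open>Meaningful for observable pairs, where the minimum exists; it is \<open>0\<close> for order \<open>0\<close>.\<close>

definition observability_index :: "real mat \<Rightarrow> real mat \<Rightarrow> nat" where
  "observability_index M N = (LEAST l. mat_rank (partial_obs_matrix l M N) = dim_row M)"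

definition unobs_dim :: "real mat \<Rightarrow> real mat \<Rightarrow> nat" where
  "unobs_dim M N = kernel_dim (obs_matrix M N)"

definition observable_decomposition ::
  "real mat \<Rightarrow> real mat \<Rightarrow> real mat \<Rightarrow> real mat \<Rightarrow> real mat \<Rightarrow> real mat \<Rightarrow> real mat \<Rightarrow> bool" where
  "observable_decomposition A F P Aob A21 Aunob Fob \<longleftrightarrow>
     (let n = dim_row A; r = dim_row F; p = unobs_dim A F in
        P \<in> carrier_mat n n \<and>
        Aob \<in> carrier_mat (n - p) (n - p) \<and>
        A21 \<in> carrier_mat p (n - p) \<and>
        Aunob \<in> carrier_mat p p \<and>
        Fob \<in> carrier_mat r (n - p) \<and>
        (\<exists>Q \<in> carrier_mat n n. inverts_mat P Q \<and> inverts_mat Q P \<and>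
           Q * A * P = four_block_mat Aob (0\<^sub>m (n - p) p) A21 Aunob) \<and>
        F * P = four_block_mat Fob (0\<^sub>m r p) (0\<^sub>m 0 (n - p)) (0\<^sub>m 0 p) \<and>
        observable Aob Fob)"


subsection \<open>Sampling\<close>

definition sampling_scheme :: "'t::{zero,linorder} list \<Rightarrow> bool" where
  "sampling_scheme ts \<longleftrightarrow> ts \<noteq> [] \<and> 0 \<le> hd ts \<and> sorted_wrt (<) ts"

definition sampled_obs_matrix_ct :: "real mat \<Rightarrow> real mat \<Rightarrow> real list \<Rightarrow> real mat" where
  "sampled_obs_matrix_ct M N ts = stack_rows (dim_col N) (map (\<lambda>t. N * mat_exp (t \<cdot>\<^sub>m M)) ts)"

definition sampled_obs_matrix_dt :: "real mat \<Rightarrow> real mat \<Rightarrow> nat list \<Rightarrow> real mat" where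
  "sampled_obs_matrix_dt M N ts = stack_rows (dim_col N) (map (\<lambda>t. N * M ^\<^sub>m t) ts)"


subsection \<open>Trajectories\<close>

text \<open>
  The state equation \<open>x' = A x + B u\<close> in integral form, with the Henstock--Kurzweil integral.
  This covers the everywhere differentiable solutions as well as the Caratheodory solutions
  for discontinuous inputs, and restricts the inputs only by integrability of the right-hand side.
\<close>

definition trajectory_ct ::
  "real mat \<Rightarrow> real mat \<Rightarrow> (real \<Rightarrow> real vec) \<Rightarrow> (real \<Rightarrow> real vec) \<Rightarrow> bool" where
  "trajectory_ct A B u x \<longleftrightarrow>
     (\<forall>t\<ge>0. u t \<in> carrier_vec (dim_col B) \<and> x t \<in> carrier_vec (dim_row A)) \<and>
     (\<forall>t\<ge>0. \<forall>i<dim_row A.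
        ((\<lambda>s. (A *\<^sub>v x s + B *\<^sub>v u s) $ i) has_integral (x t $ i - x 0 $ i)) {0..t})"

definition trajectory_dt ::
  "real mat \<Rightarrow> real mat \<Rightarrow> (nat \<Rightarrow> real vec) \<Rightarrow> (nat \<Rightarrow> real vec) \<Rightarrow> bool" where
  "trajectory_dt A B u x \<longleftrightarrow>
     (\<forall>t. u t \<in> carrier_vec (dim_col B) \<and> x t \<in> carrier_vec (dim_row A)) \<and>
     (\<forall>t. x (Suc t) = A *\<^sub>v x t + B *\<^sub>v u t)"


subsection \<open>Sample-based functional observability\<close>

text \<open>
  Unique reconstruction on \<open>[0, T]\<close>: any two trajectories that share the input on \<open>[0, T]\<close> and
  the sampled outputs have the same \<open>F x\<close> on \<open>[0, T]\<close>.
\<close>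

definition uniquely_reconstructible ::
  "(('t::{zero,linorder} \<Rightarrow> real vec) \<Rightarrow> ('t \<Rightarrow> real vec) \<Rightarrow> bool) \<Rightarrow>
   real mat \<Rightarrow> real mat \<Rightarrow> real mat \<Rightarrow> 't list \<Rightarrow> 't \<Rightarrow> bool" where
  "uniquely_reconstructible traj C D F ts T \<longleftrightarrow>
     (\<forall>u x u' x'. traj u x \<longrightarrow> traj u' x' \<longrightarrow>
        (\<forall>t\<in>{0..T}. u t = u' t) \<longrightarrow>
        (\<forall>t\<in>set ts. C *\<^sub>v x t + D *\<^sub>v u t = C *\<^sub>v x' t + D *\<^sub>v u' t) \<longrightarrow>
        (\<forall>t\<in>{0..T}. F *\<^sub>v x t = F *\<^sub>v x' t))"

text \<open>In continuous time the lower bound \<open>\<sigma>\<close> on the horizon is \<open>0\<close>.\<close>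

definition sample_based_functionally_observable_ct ::
  "real mat \<Rightarrow> real mat \<Rightarrow> real mat \<Rightarrow> real mat \<Rightarrow> real mat \<Rightarrow> real list \<Rightarrow> bool" where
  "sample_based_functionally_observable_ct A B C D F ts \<longleftrightarrow>
     (\<exists>T>0. uniquely_reconstructible (trajectory_ct A B) C D F ts T)"

text \<open>In discrete time \<open>\<sigma> = \<nu> - 2\<close> may be negative, hence an integer; the horizon is a time.\<close>

definition sample_based_functionally_observable_dt ::
  "int \<Rightarrow> real mat \<Rightarrow> real mat \<Rightarrow> real mat \<Rightarrow> real mat \<Rightarrow> real mat \<Rightarrow> nat list \<Rightarrow> bool" where
  "sample_based_functionally_observable_dt \<sigma> A B C D F ts \<longleftrightarrow>
     (\<exists>T::nat. int T > \<sigma> \<and> uniquely_reconstructible (trajectory_dt A B) C D F ts T)"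

end

theory Submission
  imports Defs
begin

text \<open>
  The difference \<open>e\<close> of two trajectories with the same input solves the homogeneous equation. The first
  \<open>n - p\<close> rows of the inverse coordinate change form a matrix \<open>W\<close> with \<open>W A = A\<^sub>o\<^sub>b W\<close> and
  \<open>F = F\<^sub>o\<^sub>b W\<close>, so \<open>W e(t) = \<Phi>(t) W e(0)\<close> with \<open>\<Phi>(t) = exp (t A\<^sub>o\<^sub>b)\<close> or \<open>\<Phi>(t) = A\<^sub>o\<^sub>b\<^sup>t\<close>. The rank
  condition on \<open>C\<close> and \<open>F\<close> says that the kernel of \<open>C\<close> lies in that of \<open>F\<close>; hence equal sampled outputs give
  \<open>F\<^sub>o\<^sub>b \<Phi>(t\<^sub>i) W e(0) = F e(t\<^sub>i) = 0\<close> at all samples, and the full column rank of the sample-based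
  observability matrix forces \<open>W e(0) = 0\<close>, that is \<open>F e(t) = 0\<close> at all times up to the horizon.
  Any horizon past the last sample and \<open>\<sigma>\<close> will do.
\<close>

unbundle no vec_syntax \<comment> \<open>leaves \<open>$\<close> to the vectors of the matrix library\<close>

subsection \<open>Rank and kernel\<close>

text \<open>Rank-nullity for the linear map \<open>v \<mapsto> M *\<^sub>v v\<close>: its image is
  the column space of \<open>M\<close>, whose dimension is the rank by definition, and its kernel is
  \<open>mat_kernel M\<close>.\<close>

lemma (in vec_space) rank_plus_dim_kernel:
  assumes M: "M \<in> carrier_mat n nc"
  shows "rank M + vectorspace.dim class_ring ((module_vec TYPE('a) nc)\<lparr>carrier := mat_kernel M\<rparr>) = nc"
proof -
  interpret U: vec_space "TYPE('a)" nc .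
  interpret L: linear_map "class_ring :: 'a ring" "module_vec TYPE('a) nc" "module_vec TYPE('a) n" "\<lambda>v. M *\<^sub>v v"
    by unfold_locales
      (use M in \<open>auto simp: LinearCombinations.module_hom_def mult_add_distrib_mat_vec mult_mat_vec class_ring_simps module_vec_simps\<close>)
  have "L.im = span (set (cols M))"
    using col_space_eq[OF M] M unfolding col_space_def L.im_def by (auto simp: module_vec_simps)
  moreover have "L.ker = mat_kernel M"
    using M by (auto simp: L.ker_def mat_kernel module_vec_simps)
  ultimately show ?thesis
    using L.rank_nullity[OF U.fin_dim] by (simp add: rank_def U.dim_is_n)
qed

text \<open>Rank-nullity gives both kernels the same finite dimension, and a subspace of full
  dimension is the whole space. The row counts \<open>k\<close> and \<open>l\<close> may differ, so
  rows can be appended to a matrix.\<close>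

lemma mat_kernel_eq_if_rank_eq:
  fixes M N :: "'a :: field mat"
  assumes M: "M \<in> carrier_mat k nc" and N: "N \<in> carrier_mat l nc"
    and sub: "mat_kernel M \<subseteq> mat_kernel N"
    and rank: "vec_space.rank k M = vec_space.rank l N"
  shows "mat_kernel M = mat_kernel N"
proof -
  interpret KM: kernel k nc M by unfold_locales (rule M)
  interpret KN: kernel l nc N by unfold_locales (rule N)
  have dims: "KM.dim = KN.dim"
    using vec_space.rank_plus_dim_kernel[OF M] vec_space.rank_plus_dim_kernel[OF N] rank by simp
  obtain S where S: "finite S" "KM.basis S" using kernel_basis_exists[OF M] by blast
  have SM: "S \<subseteq> mat_kernel M" and indpt: "\<not> KM.lin_dep S" and gen: "KM.span S = mat_kernel M"
    using S(2) unfolding KM.Ker.basis_def by auto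
  have SN: "S \<subseteq> mat_kernel N" using SM sub by blast
  have fin: "KN.Ker.fin_dim"
    using kernel_basis_exists[OF N] unfolding KN.Ker.fin_dim_def KN.Ker.basis_def by auto
  \<comment> \<open>Independence inside either kernel coincides with independence in the common
    ambient space; the final step transfers spans in the same way.\<close>
  have "\<not> KN.lin_dep S" using indpt KM.lindep_same[OF SM] KN.lindep_same[OF SN] by simp
  moreover have "card S = KM.dim" using KM.Ker.dim_basis[OF S] by simp
  ultimately have "KN.basis S"
    using KN.Ker.dim_li_is_basis[OF fin S(1) SN] dims by simp
  then have "KN.span S = mat_kernel N" unfolding KN.Ker.basis_def by auto
  then show ?thesis using gen KM.span_same[OF SM] KN.span_same[OF SN] by simp
qed

text \<open>The identity has rank \<open>nc\<close> and a trivial kernel, which lies in the kernel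
  of \<open>M\<close>; equal ranks make the two kernels coincide.\<close>

lemma full_column_rank_imp_zero:
  fixes M :: "'a :: field mat"
  assumes M: "M \<in> carrier_mat k nc" and rank: "vec_space.rank k M = nc"
    and v: "v \<in> carrier_vec nc" and zero: "M *\<^sub>v v = 0\<^sub>v k"
  shows "v = 0\<^sub>v nc"
proof -
  have "vec_space.rank nc (1\<^sub>m nc :: 'a mat) = nc"
    using vec_space.det_rank_iff[of "1\<^sub>m nc :: 'a mat" nc] by simp
  moreover have "mat_kernel (1\<^sub>m nc :: 'a mat) \<subseteq> mat_kernel M"
    using M by (auto simp: mat_kernel[OF M] mat_kernel[OF one_carrier_mat])
  ultimately have "mat_kernel (1\<^sub>m nc) = mat_kernel M"
    using rank by (intro mat_kernel_eq_if_rank_eq[OF one_carrier_mat M]) auto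
  then have "v \<in> mat_kernel (1\<^sub>m nc)" using mat_kernelI[OF M v zero] by simp
  then show ?thesis using v by (simp add: mat_kernel[OF one_carrier_mat])
qed

section \<open>Kernels of stacked matrices\<close>

lemma zero_vec_append: "0\<^sub>v (a + b) = 0\<^sub>v a @\<^sub>v 0\<^sub>v b"
  by (intro eq_vecI) auto

lemma append_rows_mult_eq_zero_iff:
  fixes M N :: "'a :: semiring_0 mat"
  assumes M: "M \<in> carrier_mat a nc" and N: "N \<in> carrier_mat b nc" and v: "v \<in> carrier_vec nc"
  shows "(M @\<^sub>r N) *\<^sub>v v = 0\<^sub>v (a + b) \<longleftrightarrow> M *\<^sub>v v = 0\<^sub>v a \<and> N *\<^sub>v v = 0\<^sub>v b"
  unfolding mat_mult_append[OF M N v] zero_vec_append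
  by (rule append_vec_eq[of _ a]) (use mult_mat_vec_carrier[OF M v] in auto)

text \<open>The kernel of the stacked matrix is the intersection of the kernels of \<open>C\<close>
  and \<open>F\<close>. Equal ranks force this intersection to be the whole kernel of
  \<open>C\<close>.\<close>

lemma kernel_subset_of_append_rank:
  assumes C: "C \<in> carrier_mat q n" and F: "F \<in> carrier_mat r n"
    and rank: "mat_rank (C @\<^sub>r F) = mat_rank C"
    and v: "v \<in> carrier_vec n" and zero: "C *\<^sub>v v = 0\<^sub>v q"
  shows "F *\<^sub>v v = 0\<^sub>v r"
proof -
  have CF: "C @\<^sub>r F \<in> carrier_mat (q + r) n" using C F by simp
  have "mat_kernel (C @\<^sub>r F) \<subseteq> mat_kernel C"
    using append_rows_mult_eq_zero_iff[OF C F] by (auto simp: mat_kernel[OF CF] mat_kernel[OF C])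
  then have "mat_kernel (C @\<^sub>r F) = mat_kernel C"
    using rank CF C by (intro mat_kernel_eq_if_rank_eq[OF CF C]) auto
  moreover have "v \<in> mat_kernel C" using mat_kernelI[OF C v zero] .
  ultimately have "v \<in> mat_kernel (C @\<^sub>r F)" by simp
  then show ?thesis
    using append_rows_mult_eq_zero_iff[OF C F v] by (simp add: mat_kernel[OF CF])
qed

lemma stack_rows_carrier:
  assumes "\<And>M. M \<in> set Ms \<Longrightarrow> M \<in> carrier_mat r nc"
  shows "stack_rows nc Ms \<in> carrier_mat (length Ms * r) nc"
  using assms by (induction Ms) (auto simp: stack_rows_def)

lemma stack_rows_mult_eq_zero:
  assumes "\<And>M. M \<in> set Ms \<Longrightarrow> M \<in> carrier_mat r nc" and v: "v \<in> carrier_vec nc"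
    and "\<And>M. M \<in> set Ms \<Longrightarrow> M *\<^sub>v v = 0\<^sub>v r"
  shows "stack_rows nc Ms *\<^sub>v v = 0\<^sub>v (length Ms * r)"
  using assms(1,3)
proof (induction Ms)
  case Nil
  then show ?case by (auto simp: stack_rows_def)
next
  case (Cons M Ms)
  have "stack_rows nc Ms \<in> carrier_mat (length Ms * r) nc"
    using Cons.prems by (intro stack_rows_carrier) auto
  then have "(M @\<^sub>r stack_rows nc Ms) *\<^sub>v v = 0\<^sub>v (r + length Ms * r)"
    using Cons append_rows_mult_eq_zero_iff[OF _ _ v, of M r] by auto
  then show ?case by (simp add: stack_rows_def)
qed

text \<open>Turns the rank condition on an observability matrix into its use: a state annihilated by
  every block is zero.\<close>

lemma full_rank_stack_imp_zero:
  assumes carrier: "\<And>M. M \<in> set Ms \<Longrightarrow> M \<in> carrier_mat r nc" and v: "v \<in> carrier_vec nc"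
    and "\<And>M. M \<in> set Ms \<Longrightarrow> M *\<^sub>v v = 0\<^sub>v r"
    and rank: "mat_rank (stack_rows nc Ms) = nc"
  shows "v = 0\<^sub>v nc"
proof -
  have stack: "stack_rows nc Ms \<in> carrier_mat (length Ms * r) nc"
    using carrier by (rule stack_rows_carrier)
  then show ?thesis
    using full_column_rank_imp_zero[OF stack _ v] stack_rows_mult_eq_zero[OF assms(1-3)] rank by simp
qed

subsection \<open>The observable subsystem\<close>

text \<open>The zero block annihilates the last \<open>p\<close> rows of \<open>Q\<close>, so the
  upper rows of the product see only \<open>mat d n (($$) Q)\<close>, the first \<open>d\<close>
  rows of \<open>Q\<close>.\<close>

lemma index_block_row_mult:
  fixes X :: "'a :: semiring_0 mat"
  assumes X: "X \<in> carrier_mat a d" and Y: "Y \<in> carrier_mat b d" and Z: "Z \<in> carrier_mat b p"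
    and Q: "Q \<in> carrier_mat (d + p) n" and i: "i < a" and j: "j < n"
  shows "(four_block_mat X (0\<^sub>m a p) Y Z * Q) $$ (i, j) = (X * mat d n (($$) Q)) $$ (i, j)"
proof -
  have "(four_block_mat X (0\<^sub>m a p) Y Z * Q) $$ (i, j)
      = (\<Sum>k\<in>{0..<d + p}. (if k < d then X $$ (i, k) else 0) * Q $$ (k, j))"
    using assms by (simp add: scalar_prod_def) (intro sum.cong, auto)
  also have "\<dots> = (\<Sum>k\<in>{0..<d}. X $$ (i, k) * Q $$ (k, j))"
    by (rule sum.mono_neutral_cong_right) auto
  also have "\<dots> = (X * mat d n (($$) Q)) $$ (i, j)"
    using assms by (simp add: scalar_prod_def)
  finally show ?thesis .
qed

text \<open>\<open>W\<close> consists of the first \<open>d\<close> rows of the inverse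
  \<open>Q\<close> of \<open>P\<close>, so it maps a state to its observable coordinates. The two
  identities are the upper block rows of \<open>Q A = (Q A P) Q\<close> and
  \<open>F = (F P) Q\<close>.\<close>

lemma observable_decomposition_projection:
  assumes A: "A \<in> carrier_mat n n" and F: "F \<in> carrier_mat r n"
    and decomp: "observable_decomposition A F P Aob A21 Aunob Fob"
    and d: "d = n - unobs_dim A F"
  obtains W where "W \<in> carrier_mat d n" "W * A = Aob * W" "F = Fob * W"
    "Aob \<in> carrier_mat d d" "Fob \<in> carrier_mat r d"
proof -
  define p where "p = unobs_dim A F"
  have dims: "dim_row A = n" "dim_row F = r" "unobs_dim A F = p" "n - p = d"
    using A F d by (auto simp: p_def)
  note decomp' = decomp[unfolded observable_decomposition_def Let_def dims]
  then have P: "P \<in> carrier_mat n n" and Aob: "Aob \<in> carrier_mat d d"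
    and A21: "A21 \<in> carrier_mat p d" and Aunob: "Aunob \<in> carrier_mat p p"
    and Fob: "Fob \<in> carrier_mat r d"
    and FP: "F * P = four_block_mat Fob (0\<^sub>m r p) (0\<^sub>m 0 d) (0\<^sub>m 0 p)"
    by simp_all
  from decomp' obtain Q where Q: "Q \<in> carrier_mat n n" and "inverts_mat P Q"
    and QAP: "Q * A * P = four_block_mat Aob (0\<^sub>m d p) A21 Aunob"
    by blast
  then have PQ: "P * Q = 1\<^sub>m n" using P by (simp add: inverts_mat_def)
  \<comment> \<open>Since \<open>d\<close> is the truncated difference \<open>n - p\<close>, the
    equation \<open>n = d + p\<close> has to be established; it is read off from the row counts of
    the block form.\<close>
  have "dim_row (Q * A * P) = d + p" unfolding QAP using Aob Aunob by simp
  then have n: "n = d + p" using Q by simp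
  define W where "W = mat d n (($$) Q)"
  have W: "W \<in> carrier_mat d n" by (simp add: W_def)
  have Qdp: "Q \<in> carrier_mat (d + p) n" using Q n by simp
  have "Q * A = Q * A * (P * Q)" using PQ Q A by simp
  also have "\<dots> = Q * A * P * Q" using assoc_mult_mat[of "Q * A" n n P n Q n] P Q A by simp
  finally have QA: "Q * A = Q * A * P * Q" .
  have "W * A = Aob * W"
  proof (rule eq_matI)
    fix i j assume "i < dim_row (Aob * W)" "j < dim_col (Aob * W)"
    then have ij: "i < d" "j < n" using Aob W by auto
    then have "(W * A) $$ (i, j) = (Q * A) $$ (i, j)"
      using A Q n by (auto simp: W_def scalar_prod_def)
    also have "\<dots> = (Aob * W) $$ (i, j)"
      by (subst QA) (unfold QAP W_def, rule index_block_row_mult[OF Aob A21 Aunob Qdp ij])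
    finally show "(W * A) $$ (i, j) = (Aob * W) $$ (i, j)" .
  qed (use Aob W A in auto)
  moreover have "F = Fob * W"
  proof (rule eq_matI)
    fix i j assume "i < dim_row (Fob * W)" "j < dim_col (Fob * W)"
    then have ij: "i < r" "j < n" using Fob W by auto
    have "F = F * P * Q" using PQ F assoc_mult_mat[OF F P Q] by simp
    \<comment> \<open>Here the lower blocks have height 0, so \<open>index_block_row_mult\<close>
      applies with \<open>b = 0\<close>.\<close>
    also have "\<dots> $$ (i, j) = (Fob * W) $$ (i, j)" unfolding FP W_def
      by (rule index_block_row_mult[OF Fob zero_carrier_mat zero_carrier_mat Qdp ij])
    finally show "F $$ (i, j) = (Fob * W) $$ (i, j)" .
  qed (use Fob W F in auto)
  ultimately show ?thesis using that W Aob Fob by blast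
qed


subsection \<open>Matrix exponential and linear differential equations\<close>

lemma smult_mat_pow:
  fixes M :: "'a :: comm_semiring_1 mat"
  assumes M: "M \<in> carrier_mat n n"
  shows "(t \<cdot>\<^sub>m M) ^\<^sub>m k = t ^ k \<cdot>\<^sub>m M ^\<^sub>m k"
proof (induction k)
  case 0
  then show ?case using M by (auto intro!: eq_matI)
next
  case (Suc k)
  have "M ^\<^sub>m k \<in> carrier_mat n n" using M by simp
  then show ?case using Suc M by (auto intro!: eq_matI simp: algebra_simps)
qed

lemma mat_pow_Suc_index:
  assumes M: "(M :: 'a :: semiring_1 mat) \<in> carrier_mat n n" and "i < n" "j < n"
  shows "(M ^\<^sub>m Suc k) $$ (i, j) = (\<Sum>l<n. (M ^\<^sub>m k) $$ (i, l) * M $$ (l, j))"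
proof -
  have "M ^\<^sub>m k \<in> carrier_mat n n" using M by simp
  then show ?thesis using assms by (simp add: scalar_prod_def atLeast0LessThan)
qed

text \<open>The sum of the absolute values of all entries serves as a crude matrix norm. In the
  induction, enlarging \<open>\<bar>M $$ (l, j)\<bar>\<close> to the absolute sum of row
  \<open>l\<close> makes the sum over \<open>l\<close> contribute exactly one more factor.\<close>

lemma abs_mat_pow_le:
  fixes M :: "real mat"
  assumes M: "M \<in> carrier_mat n n" and "i < n" "j < n"
  shows "\<bar>(M ^\<^sub>m k) $$ (i, j)\<bar> \<le> (\<Sum>a<n. \<Sum>b<n. \<bar>M $$ (a, b)\<bar>) ^ k" (is "_ \<le> ?c ^ k")
  using assms(3)
proof (induction k arbitrary: j)
  case 0
  then show ?case using M \<open>i < n\<close> by simp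
next
  case (Suc k)
  have c: "0 \<le> ?c" by (intro sum_nonneg) auto
  have "\<bar>(M ^\<^sub>m Suc k) $$ (i, j)\<bar> \<le> (\<Sum>l<n. \<bar>(M ^\<^sub>m k) $$ (i, l)\<bar> * \<bar>M $$ (l, j)\<bar>)"
    unfolding mat_pow_Suc_index[OF M \<open>i < n\<close> Suc.prems] by (rule order_trans[OF sum_abs]) (simp add: abs_mult)
  also have "\<dots> \<le> (\<Sum>l<n. ?c ^ k * (\<Sum>b<n. \<bar>M $$ (l, b)\<bar>))"
    using Suc c by (intro sum_mono mult_mono member_le_sum) auto
  also have "\<dots> = ?c ^ Suc k" by (simp add: sum_distrib_right mult.commute)
  finally show ?case .
qed

text \<open>Comparison with the scalar exponential series. The terms are written as a power series
  in \<open>t\<close>, the form in which termwise differentiation applies.\<close>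

lemma summable_mat_exp_index:
  fixes M :: "real mat"
  assumes "M \<in> carrier_mat n n" "i < n" "j < n"
  shows "summable (\<lambda>k. (M ^\<^sub>m k) $$ (i, j) / fact k * t ^ k)"
proof (rule summable_comparison_test)
  let ?c = "\<Sum>a<n. \<Sum>b<n. \<bar>M $$ (a, b)\<bar>"
  show "summable (\<lambda>k. (?c * \<bar>t\<bar>) ^ k /\<^sub>R fact k)" by (rule summable_exp_generic)
  show "\<exists>N. \<forall>k\<ge>N. norm ((M ^\<^sub>m k) $$ (i, j) / fact k * t ^ k) \<le> (?c * \<bar>t\<bar>) ^ k /\<^sub>R fact k"
    using abs_mat_pow_le[OF assms]
    by (auto simp: abs_mult power_abs power_mult_distrib divide_simps intro!: mult_right_mono exI[of _ 0])
qed

lemma mat_exp_smult_index: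
  assumes "M \<in> carrier_mat n n" "i < n" "j < n"
  shows "mat_exp (t \<cdot>\<^sub>m M) $$ (i, j) = (\<Sum>k. (M ^\<^sub>m k) $$ (i, j) / fact k * t ^ k)"
proof -
  have "M ^\<^sub>m k \<in> carrier_mat n n" for k using assms by simp
  then have "((t \<cdot>\<^sub>m M) ^\<^sub>m k) $$ (i, j) = t ^ k * (M ^\<^sub>m k) $$ (i, j)" for k
    using assms by (subst smult_mat_pow[OF assms(1)]) auto
  then show ?thesis using assms by (simp add: mat_exp_def algebra_simps)
qed

lemma mat_exp_carrier: "M \<in> carrier_mat n n \<Longrightarrow> mat_exp M \<in> carrier_mat n n"
  by (simp add: mat_exp_def)

lemma mat_exp_zero:
  assumes "M \<in> carrier_mat n n"
  shows "mat_exp (0 \<cdot>\<^sub>m M) = 1\<^sub>m n"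
proof (rule eq_matI)
  fix i j assume "i < dim_row (1\<^sub>m n :: real mat)" "j < dim_col (1\<^sub>m n :: real mat)"
  then show "mat_exp (0 \<cdot>\<^sub>m M) $$ (i, j) = 1\<^sub>m n $$ (i, j)"
    using assms powser_zero[of "\<lambda>k. (M ^\<^sub>m k) $$ (i, j) / fact k"] by (simp add: mat_exp_smult_index)
qed (use assms in \<open>auto simp: mat_exp_def\<close>)

text \<open>Termwise differentiation of the entry series. The shifted coefficients contain
  \<open>M ^\<^sub>m Suc k\<close>; splitting off its last factor gives the entry of
  \<open>exp (t M) M\<close>.\<close>

lemma has_real_derivative_mat_exp_index:
  assumes M: "M \<in> carrier_mat n n" and i: "i < n" and j: "j < n"
  shows "((\<lambda>t. mat_exp (t \<cdot>\<^sub>m M) $$ (i, j)) has_real_derivative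
    (\<Sum>l<n. mat_exp (t \<cdot>\<^sub>m M) $$ (i, l) * M $$ (l, j))) (at t)"
proof -
  let ?c = "\<lambda>l k. (M ^\<^sub>m k) $$ (i, l) / fact k"
  have "diffs (?c j) k = (\<Sum>l<n. ?c l k * M $$ (l, j))" for k
  proof -
    have "diffs (?c j) k = (M ^\<^sub>m Suc k) $$ (i, j) / fact k"
      by (simp add: diffs_def divide_simps del: pow_mat.simps of_nat_Suc)
    then show ?thesis unfolding mat_pow_Suc_index[OF M i j] by (simp add: sum_divide_distrib)
  qed
  then have "(\<Sum>k. diffs (?c j) k * t ^ k) = (\<Sum>k. \<Sum>l<n. ?c l k * t ^ k * M $$ (l, j))"
    by (simp only: sum_distrib_left mult_ac)
  also have "\<dots> = (\<Sum>l<n. \<Sum>k. ?c l k * t ^ k * M $$ (l, j))"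
    using summable_mat_exp_index[OF M i] by (intro suminf_sum summable_mult2) auto
  also have "\<dots> = (\<Sum>l<n. mat_exp (t \<cdot>\<^sub>m M) $$ (i, l) * M $$ (l, j))"
    using summable_mat_exp_index[OF M i] M i
    by (intro sum.cong) (auto simp: mat_exp_smult_index suminf_mult2)
  finally have "(\<Sum>k. diffs (?c j) k * t ^ k) = \<dots>" .
  moreover have "((\<lambda>t. \<Sum>k. ?c j k * t ^ k) has_real_derivative (\<Sum>k. diffs (?c j) k * t ^ k)) (at t)"
    using summable_mat_exp_index[OF M i j] by (intro termdiffs_strong_converges_everywhere)
  ultimately show ?thesis using M i j by (simp add: mat_exp_smult_index)
qed

section \<open>Linear differential and integral equations\<close>

text \<open>The curve \<open>s \<mapsto> exp ((t - s) M) z(s)\<close> is constant on \<open>[0, t]\<close>.\<close>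

lemma linear_ode_solution:
  assumes M: "M \<in> carrier_mat n n" and t: "0 \<le> t"
    and z: "\<And>s. s \<in> {0..t} \<Longrightarrow> z s \<in> carrier_vec n"
    and ode: "\<And>s i. s \<in> {0..t} \<Longrightarrow> i < n \<Longrightarrow>
      ((\<lambda>s. z s $ i) has_real_derivative (M *\<^sub>v z s) $ i) (at s within {0..t})"
  shows "z t = mat_exp (t \<cdot>\<^sub>m M) *\<^sub>v z 0"
proof -
  define w where "w i s = (\<Sum>j<n. mat_exp ((t - s) \<cdot>\<^sub>m M) $$ (i, j) * z s $ j)" for i s
  have Mz: "(M *\<^sub>v z s) $ j = (\<Sum>l<n. M $$ (j, l) * z s $ l)" if "s \<in> {0..t}" "j < n" for s j
    using z[OF that(1)] that M by (auto simp: scalar_prod_def atLeast0LessThan)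
  have der: "(w i has_real_derivative 0) (at s within {0..t})" if s: "s \<in> {0..t}" and i: "i < n" for i s
  proof -
    let ?E = "\<lambda>j. mat_exp ((t - s) \<cdot>\<^sub>m M) $$ (i, j)"
    have E: "((\<lambda>s. mat_exp ((t - s) \<cdot>\<^sub>m M) $$ (i, j)) has_real_derivative
        - (\<Sum>l<n. ?E l * M $$ (l, j))) (at s within {0..t})" if "j < n" for j
    proof -
      have "((\<lambda>s. t - s) has_real_derivative -1) (at s within {0..t})"
        by (auto intro!: derivative_eq_intros)
      from DERIV_chain2[OF has_real_derivative_mat_exp_index[OF M i that] this] show ?thesis by simp
    qed
    have "(w i has_real_derivative
        (\<Sum>j<n. - (\<Sum>l<n. ?E l * M $$ (l, j)) * z s $ j + (M *\<^sub>v z s) $ j * ?E j)) (at s within {0..t})"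
      unfolding w_def using s by (intro DERIV_sum DERIV_mult E ode) auto
    also have "(\<Sum>j<n. - (\<Sum>l<n. ?E l * M $$ (l, j)) * z s $ j + (M *\<^sub>v z s) $ j * ?E j)
        = (\<Sum>j<n. \<Sum>l<n. M $$ (j, l) * z s $ l * ?E j) - (\<Sum>j<n. \<Sum>l<n. ?E l * M $$ (l, j) * z s $ j)"
      by (simp add: Mz[OF s] sum.distrib sum_distrib_right sum_negf sum_subtractf)
    \<comment> \<open>The product rule leaves two double sums that agree once the summation indices
      of one are exchanged.\<close>
    also have "\<dots> = 0"
      by (subst (2) sum.swap) (simp add: mult_ac)
    finally show ?thesis .
  qed
  have const: "w i t = w i 0" if i: "i < n" for i
  proof -
    obtain c where "\<And>s. s \<in> {0..t} \<Longrightarrow> w i s = c"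
      using has_field_derivative_zero_constant[of "{0..t}" "w i"] der[OF _ i] by auto
    then show ?thesis using t by simp
  qed
  \<comment> \<open>The claim compares the two endpoints: the curve is \<open>exp (t M) z(0)\<close>
    at \<open>s = 0\<close> and, as \<open>exp 0\<close> is the identity, \<open>z(t)\<close> at
    \<open>s = t\<close>.\<close>
  have w0: "w i 0 = (mat_exp (t \<cdot>\<^sub>m M) *\<^sub>v z 0) $ i" if "i < n" for i
    using that M z[of 0] t mat_exp_carrier[of "t \<cdot>\<^sub>m M" n]
    by (auto simp: w_def scalar_prod_def atLeast0LessThan)
  have wt: "w i t = z t $ i" if "i < n" for i
    using that by (simp add: w_def mat_exp_zero[OF M] if_distrib[of "\<lambda>x. x * _"] cong: if_cong)
  show ?thesis
    using M z[of t] t const w0 wt mat_exp_carrier[of "t \<cdot>\<^sub>m M" n] by (intro eq_vecI) auto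
qed

text \<open>Regularity is bootstrapped: \<open>z\<close> is an indefinite integral up to a constant,
  hence continuous; so the integrand \<open>M z\<close> is continuous, and the fundamental theorem
  of calculus yields the differential equation.\<close>

lemma linear_integral_equation_solution:
  assumes M: "M \<in> carrier_mat n n" and t: "0 \<le> t"
    and z: "\<And>s. s \<in> {0..t} \<Longrightarrow> z s \<in> carrier_vec n"
    and eq: "\<And>s i. s \<in> {0..t} \<Longrightarrow> i < n \<Longrightarrow>
      ((\<lambda>s. (M *\<^sub>v z s) $ i) has_integral z s $ i - z 0 $ i) {0..s}"
  shows "z t = mat_exp (t \<cdot>\<^sub>m M) *\<^sub>v z 0"
proof (rule linear_ode_solution[OF M t z])
  let ?g = "\<lambda>i s. (M *\<^sub>v z s) $ i"
  have repr: "z 0 $ i + integral {0..s} (?g i) = z s $ i" if "s \<in> {0..t}" "i < n" for s i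
    using integral_unique[OF eq[OF that]] by simp
  have "continuous_on {0..t} (\<lambda>s. z 0 $ i + integral {0..s} (?g i))" if "i < n" for i
    using eq[of t i] t that by (intro continuous_intros indefinite_integral_continuous_1) auto
  then have cont: "continuous_on {0..t} (\<lambda>s. z s $ i)" if "i < n" for i
    by (rule continuous_on_eq) (use that repr in auto)
  have cont_g: "continuous_on {0..t} (?g i)" if "i < n" for i
  proof (rule continuous_on_eq)
    show "continuous_on {0..t} (\<lambda>s. \<Sum>l<n. M $$ (i, l) * z s $ l)"
      by (intro continuous_intros cont) auto
    show "(\<Sum>l<n. M $$ (i, l) * z s $ l) = ?g i s" if "s \<in> {0..t}" for s
      using z[OF that] M \<open>i < n\<close> by (auto simp: scalar_prod_def atLeast0LessThan)
  qed
  fix s i assume s: "s \<in> {0..t}" and i: "i < n"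
  have "((\<lambda>s. z 0 $ i + integral {0..s} (?g i)) has_real_derivative ?g i s) (at s within {0..t})"
    using integral_has_real_derivative[OF cont_g[OF i] s] by (auto intro!: derivative_eq_intros)
  \<comment> \<open>The identity \<open>repr\<close> holds on the whole interval, so any positive
    radius serves as \<open>d\<close>.\<close>
  then show "((\<lambda>s. z s $ i) has_real_derivative ?g i s) (at s within {0..t})"
    by (rule has_field_derivative_transform_within[where d = 1]) (use s repr i in auto)
qed


subsection \<open>Reconstruction from samples\<close>

lemma sampling_scheme_nonneg:
  assumes "sampling_scheme ts" "t \<in> set ts"
  shows "0 \<le> t"
  using assms by (cases ts) (auto simp: sampling_scheme_def)

text \<open>The core shared by both time settings, with \<open>\<Phi>\<close> standing for the
  matrix exponential or the matrix power. Vanishing of \<open>C e\<close> at the samples gives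
  vanishing of \<open>F e\<close> there, hence \<open>W e(0) = 0\<close> by the rank condition, and
  the flow carries this to the whole horizon.\<close>

lemma vanishing_output_of_vanishing_samples:
  assumes C: "C \<in> carrier_mat q n" and F: "F \<in> carrier_mat r n"
    and rank_CF: "mat_rank (C @\<^sub>r F) = mat_rank C"
    and W: "W \<in> carrier_mat d n" and FW: "F = Fob * W" and Fob: "Fob \<in> carrier_mat r d"
    and \<Phi>: "\<And>t. \<Phi> t \<in> carrier_mat d d"
    and rank: "mat_rank (stack_rows d (map (\<lambda>t. Fob * \<Phi> t) ts)) = d"
    and ts: "set ts \<subseteq> {0..T :: 't :: {zero,linorder}}" and T: "0 \<le> T"
    and e: "\<And>t. t \<in> {0..T} \<Longrightarrow> e t \<in> carrier_vec n"
    and flow: "\<And>t. t \<in> {0..T} \<Longrightarrow> W *\<^sub>v e t = \<Phi> t *\<^sub>v (W *\<^sub>v e 0)"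
    and samples: "\<And>t. t \<in> set ts \<Longrightarrow> C *\<^sub>v e t = 0\<^sub>v q"
    and t: "t \<in> {0..T}"
  shows "F *\<^sub>v e t = 0\<^sub>v r"
proof -
  let ?w = "W *\<^sub>v e 0"
  have w: "?w \<in> carrier_vec d" using W e[of 0] T by auto
  have out: "F *\<^sub>v e t = Fob * \<Phi> t *\<^sub>v ?w" if "t \<in> {0..T}" for t
    using flow[OF that] assoc_mult_mat_vec[OF Fob W e[OF that]] assoc_mult_mat_vec[OF Fob \<Phi> w] FW
    by simp
  have "?w = 0\<^sub>v d"
  proof (rule full_rank_stack_imp_zero[OF _ w _ rank])
    fix M assume "M \<in> set (map (\<lambda>t. Fob * \<Phi> t) ts)"
    then obtain t where t: "t \<in> set ts" and M: "M = Fob * \<Phi> t" by auto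
    show "M \<in> carrier_mat r d" unfolding M using Fob \<Phi> by simp
    have "t \<in> {0..T}" using t ts by auto
    then show "M *\<^sub>v ?w = 0\<^sub>v r"
      using kernel_subset_of_append_rank[OF C F rank_CF e samples] t out M by simp
  qed
  then show ?thesis
    using out[OF t] mult_carrier_mat[OF Fob \<Phi>, of t] by (intro eq_vecI) (auto simp: scalar_prod_def)
qed

section \<open>Differences of trajectories\<close>

lemma diff_vec_eq_zero_iff:
  fixes v w :: "'a :: group_add vec"
  assumes "v \<in> carrier_vec n" "w \<in> carrier_vec n"
  shows "v - w = 0\<^sub>v n \<longleftrightarrow> v = w"
  using assms by (auto simp: vec_eq_iff)

lemma mult_diff_vec_eq_zero_iff:
  fixes M :: "'a :: ring mat"
  assumes "M \<in> carrier_mat k n" "x \<in> carrier_vec n" "y \<in> carrier_vec n"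
  shows "M *\<^sub>v (x - y) = 0\<^sub>v k \<longleftrightarrow> M *\<^sub>v x = M *\<^sub>v y"
  using assms by (simp add: mult_minus_distrib_mat_vec diff_vec_eq_zero_iff[of _ k])

lemma add_vec_right_cancel:
  fixes x y z :: "'a :: cancel_semigroup_add vec"
  assumes "x \<in> carrier_vec n" "y \<in> carrier_vec n" "z \<in> carrier_vec n" "x + z = y + z"
  shows "x = y"
proof (rule eq_vecI)
  fix i assume "i < dim_vec y"
  moreover have "(x + z) $ i = (y + z) $ i" using assms(4) by (simp only:)
  ultimately show "x $ i = y $ i" using assms(1-3) by simp
qed (use assms in auto)

text \<open>The whole right-hand sides are subtracted, since these are what the definition of a
  trajectory integrates; the input terms then cancel pointwise on \<open>[0, t]\<close>, where the
  inputs agree.\<close>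

lemma trajectory_ct_difference:
  assumes A: "A \<in> carrier_mat n n" and B: "B \<in> carrier_mat n m"
    and x: "trajectory_ct A B u x" and x': "trajectory_ct A B u' x'"
    and u: "\<forall>t\<in>{0..T}. u t = u' t" and t: "t \<in> {0..T}" and i: "i < n"
  shows "((\<lambda>s. (A *\<^sub>v (x s - x' s)) $ i) has_integral (x t - x' t) $ i - (x 0 - x' 0) $ i) {0..t}"
proof -
  have carr: "x s \<in> carrier_vec n" "x' s \<in> carrier_vec n" "u s \<in> carrier_vec m" if "0 \<le> s" for s
    using x x' A B that unfolding trajectory_ct_def by auto
  let ?f = "\<lambda>x u s. (A *\<^sub>v x s + B *\<^sub>v u s) $ i"
  have "((\<lambda>s. ?f x u s - ?f x' u' s) has_integral
      (x t $ i - x 0 $ i) - (x' t $ i - x' 0 $ i)) {0..t}"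
    using x x' A t i unfolding trajectory_ct_def by (intro has_integral_diff) auto
  moreover have "?f x u s - ?f x' u' s = (A *\<^sub>v (x s - x' s)) $ i" if "s \<in> {0..t}" for s
  proof -
    have "u' s = u s" "0 \<le> s" using u t that by auto
    then show ?thesis
      using mult_minus_distrib_mat_vec[OF A, of "x s" "x' s"] carr[of s] A B i by simp
  qed
  ultimately have "((\<lambda>s. (A *\<^sub>v (x s - x' s)) $ i) has_integral
      (x t $ i - x 0 $ i) - (x' t $ i - x' 0 $ i)) {0..t}"
    by (rule has_integral_eq[rotated]) auto
  moreover have "(x t $ i - x 0 $ i) - (x' t $ i - x' 0 $ i) = (x t - x' t) $ i - (x 0 - x' 0) $ i"
    using carr(2)[of t] carr(2)[of 0] t i by simp
  ultimately show ?thesis by simp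
qed

text \<open>Integrals are taken coordinate by coordinate, so a constant matrix passes through by
  linearity over a finite sum.\<close>

lemma has_integral_mult_mat_vec_index:
  fixes W :: "real mat"
  assumes W: "W \<in> carrier_mat d n" and f: "\<And>s. s \<in> S \<Longrightarrow> f s \<in> carrier_vec n"
    and y: "y \<in> carrier_vec n" and i: "i < d"
    and int: "\<And>j. j < n \<Longrightarrow> ((\<lambda>s. f s $ j) has_integral y $ j) S"
  shows "((\<lambda>s. (W *\<^sub>v f s) $ i) has_integral (W *\<^sub>v y) $ i) S"
proof -
  have "((\<lambda>s. \<Sum>j<n. W $$ (i, j) * f s $ j) has_integral (\<Sum>j<n. W $$ (i, j) * y $ j)) S"
    by (rule has_integral_sum) (auto intro!: has_integral_mult_right int)
  moreover have "(\<Sum>j<n. W $$ (i, j) * y $ j) = (W *\<^sub>v y) $ i"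
    using W y i by (auto simp: scalar_prod_def atLeast0LessThan)
  ultimately have int': "((\<lambda>s. \<Sum>j<n. W $$ (i, j) * f s $ j) has_integral (W *\<^sub>v y) $ i) S"
    by (simp only:)
  have "(\<Sum>j<n. W $$ (i, j) * f s $ j) = (W *\<^sub>v f s) $ i" if "s \<in> S" for s
    using W f[OF that] i by (auto simp: scalar_prod_def atLeast0LessThan)
  then show ?thesis by (rule has_integral_eq[OF _ int'])
qed

text \<open>Applying \<open>W\<close> to the integral equation of the difference and using
  \<open>W A = M W\<close> gives a closed homogeneous equation of order \<open>d\<close> for the
  projected difference.\<close>

lemma projected_difference_ct:
  assumes A: "A \<in> carrier_mat n n" and B: "B \<in> carrier_mat n m"
    and W: "W \<in> carrier_mat d n" and M: "M \<in> carrier_mat d d" and WA: "W * A = M * W"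
    and x: "trajectory_ct A B u x" and x': "trajectory_ct A B u' x'"
    and u: "\<forall>t\<in>{0..T}. u t = u' t" and t: "t \<in> {0..T}"
  shows "W *\<^sub>v (x t - x' t) = mat_exp (t \<cdot>\<^sub>m M) *\<^sub>v (W *\<^sub>v (x 0 - x' 0))"
proof (rule linear_integral_equation_solution[OF M, of t "\<lambda>t. W *\<^sub>v (x t - x' t)"])
  have e: "x s - x' s \<in> carrier_vec n" if "0 \<le> s" for s
    using x x' A that unfolding trajectory_ct_def by auto
  then show "W *\<^sub>v (x s - x' s) \<in> carrier_vec d" if "s \<in> {0..t}" for s
    using W that by simp
  fix s i assume s: "s \<in> {0..t}" and i: "i < d"
  have "((\<lambda>s. (W *\<^sub>v (A *\<^sub>v (x s - x' s))) $ i) has_integral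
      (W *\<^sub>v ((x s - x' s) - (x 0 - x' 0))) $ i) {0..s}"
  proof (rule has_integral_mult_mat_vec_index[OF W _ _ i])
    fix j assume j: "j < n"
    have "s \<in> {0..T}" using s t by auto
    from trajectory_ct_difference[OF A B x x' u this j]
    show "((\<lambda>s. (A *\<^sub>v (x s - x' s)) $ j) has_integral ((x s - x' s) - (x 0 - x' 0)) $ j) {0..s}"
      using carrier_vecD[OF e[of 0]] j by simp
  qed (use A e s in auto)
  moreover have "(W *\<^sub>v ((x s - x' s) - (x 0 - x' 0))) $ i
      = (W *\<^sub>v (x s - x' s)) $ i - (W *\<^sub>v (x 0 - x' 0)) $ i"
    using mult_minus_distrib_mat_vec[OF W e e, of s 0] s i W by simp
  ultimately have int: "((\<lambda>s. (W *\<^sub>v (A *\<^sub>v (x s - x' s))) $ i) has_integral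
      (W *\<^sub>v (x s - x' s)) $ i - (W *\<^sub>v (x 0 - x' 0)) $ i) {0..s}"
    by (simp only:)
  have WAM: "W *\<^sub>v (A *\<^sub>v (x \<tau> - x' \<tau>)) = M *\<^sub>v (W *\<^sub>v (x \<tau> - x' \<tau>))" if "\<tau> \<in> {0..s}" for \<tau>
    using assoc_mult_mat_vec[OF W A e] assoc_mult_mat_vec[OF M W e] WA that by simp
  show "((\<lambda>s. (M *\<^sub>v (W *\<^sub>v (x s - x' s))) $ i) has_integral
      (W *\<^sub>v (x s - x' s)) $ i - (W *\<^sub>v (x 0 - x' 0)) $ i) {0..s}"
    by (rule has_integral_eq[OF _ int]) (simp only: WAM)
next
  show "0 \<le> t" using t by simp
qed

text \<open>Matrix powers grow by a factor on the right, whereas the state recursion multiplies on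
  the left.\<close>

lemma pow_mat_Suc_left:
  assumes M: "M \<in> carrier_mat n n"
  shows "M ^\<^sub>m Suc k = M * M ^\<^sub>m k"
proof (induction k)
  case (Suc k)
  have "M ^\<^sub>m Suc (Suc k) = M * M ^\<^sub>m k * M" using Suc by simp
  also have "\<dots> = M * (M ^\<^sub>m k * M)" by (rule assoc_mult_mat[OF M _ M]) (use M in simp)
  finally show ?case by simp
qed (use M in simp)

text \<open>Induction on time: with equal inputs, the difference \<open>e\<close> satisfies
  \<open>W e(t + 1) = W A e(t) = M W e(t)\<close>.\<close>

lemma projected_difference_dt:
  assumes A: "A \<in> carrier_mat n n" and B: "B \<in> carrier_mat n m"
    and W: "W \<in> carrier_mat d n" and M: "M \<in> carrier_mat d d" and WA: "W * A = M * W"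
    and x: "trajectory_dt A B u x" and x': "trajectory_dt A B u' x'"
    and u: "\<forall>t\<in>{0..T}. u t = u' t" and t: "t \<in> {0..T}"
  shows "W *\<^sub>v (x t - x' t) = M ^\<^sub>m t *\<^sub>v (W *\<^sub>v (x 0 - x' 0))"
  using t
proof (induction t)
  case 0
  have "x 0 - x' 0 \<in> carrier_vec n" using x x' A unfolding trajectory_dt_def by auto
  then have "W *\<^sub>v (x 0 - x' 0) \<in> carrier_vec d" using W by simp
  then show ?case using M by simp
next
  case (Suc t)
  have carr: "x s \<in> carrier_vec n" "x' s \<in> carrier_vec n" "u s \<in> carrier_vec m" for s
    using x x' A B unfolding trajectory_dt_def by auto
  have e: "x s - x' s \<in> carrier_vec n" for s using carr[of s] by simp
  have We: "W *\<^sub>v (x 0 - x' 0) \<in> carrier_vec d" using W e[of 0] by simp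
  have Mt: "M ^\<^sub>m t \<in> carrier_mat d d" using M by simp
  have "u' t = u t" using u Suc.prems by auto
  then have "x (Suc t) - x' (Suc t) = (A *\<^sub>v x t + B *\<^sub>v u t) - (A *\<^sub>v x' t + B *\<^sub>v u t)"
    using x x' unfolding trajectory_dt_def by simp
  also have "\<dots> = A *\<^sub>v (x t - x' t)"
    unfolding mult_minus_distrib_mat_vec[OF A carr(1,2)]
    using A B by (intro eq_vecI) auto
  finally have "W *\<^sub>v (x (Suc t) - x' (Suc t)) = W * A *\<^sub>v (x t - x' t)"
    using assoc_mult_mat_vec[OF W A e] by simp
  also have "\<dots> = M *\<^sub>v (M ^\<^sub>m t *\<^sub>v (W *\<^sub>v (x 0 - x' 0)))"
    unfolding WA assoc_mult_mat_vec[OF M W e] using Suc by simp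
  also have "\<dots> = M * M ^\<^sub>m t *\<^sub>v (W *\<^sub>v (x 0 - x' 0))"
    using assoc_mult_mat_vec[OF M Mt We] by simp
  also have "M * M ^\<^sub>m t = M ^\<^sub>m Suc t"
    using pow_mat_Suc_left[OF M] by simp
  finally show ?case .
qed

text \<open>Passes from two trajectories to their difference, to which
  \<open>vanishing_output_of_vanishing_samples\<close> applies.\<close>

lemma uniquely_reconstructible_of_flow:
  assumes C: "C \<in> carrier_mat q n" and D: "D \<in> carrier_mat q m" and F: "F \<in> carrier_mat r n"
    and rank_CF: "mat_rank (C @\<^sub>r F) = mat_rank C"
    and W: "W \<in> carrier_mat d n" and FW: "F = Fob * W" and Fob: "Fob \<in> carrier_mat r d"
    and \<Phi>: "\<And>t. \<Phi> t \<in> carrier_mat d d"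
    and rank: "mat_rank (stack_rows d (map (\<lambda>t. Fob * \<Phi> t) ts)) = d"
    and ts: "set ts \<subseteq> {0..T :: 't :: {zero,linorder}}" and T: "0 \<le> T"
    and carr: "\<And>u x t. traj u x \<Longrightarrow> 0 \<le> t \<Longrightarrow> x t \<in> carrier_vec n \<and> u t \<in> carrier_vec m"
    and flow: "\<And>u x u' x' t. traj u x \<Longrightarrow> traj u' x' \<Longrightarrow> \<forall>t\<in>{0..T}. u t = u' t \<Longrightarrow> t \<in> {0..T} \<Longrightarrow>
      W *\<^sub>v (x t - x' t) = \<Phi> t *\<^sub>v (W *\<^sub>v (x 0 - x' 0))"
  shows "uniquely_reconstructible traj C D F ts T"
  unfolding uniquely_reconstructible_def
proof (intro allI impI ballI)
  fix u x u' x' t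
  assume x: "traj u x" and x': "traj u' x'" and u: "\<forall>t\<in>{0..T}. u t = u' t"
    and y: "\<forall>t\<in>set ts. C *\<^sub>v x t + D *\<^sub>v u t = C *\<^sub>v x' t + D *\<^sub>v u' t" and t: "t \<in> {0..T}"
  have carr': "x s \<in> carrier_vec n" "x' s \<in> carrier_vec n" "u s \<in> carrier_vec m" if "s \<in> {0..T}" for s
    using carr[OF x] carr[OF x'] that by auto
  have "F *\<^sub>v (x t - x' t) = 0\<^sub>v r"
  proof (rule vanishing_output_of_vanishing_samples[OF C F rank_CF W FW Fob \<Phi> rank ts T _ _ _ t])
    show "W *\<^sub>v (x s - x' s) = \<Phi> s *\<^sub>v (W *\<^sub>v (x 0 - x' 0))" if "s \<in> {0..T}" for s
      using flow[OF x x' u that] .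
    show "C *\<^sub>v (x s - x' s) = 0\<^sub>v q" if "s \<in> set ts" for s
    proof -
      \<comment> \<open>The horizon covers every sample, so the inputs agree at \<open>s\<close> and
        the feedthrough term \<open>D u\<close> cancels from the sampled outputs.\<close>
      have s: "s \<in> {0..T}" using ts that by auto
      then have "C *\<^sub>v x s + D *\<^sub>v u s = C *\<^sub>v x' s + D *\<^sub>v u s" using bspec[OF y that] bspec[OF u s] by simp
      moreover have "C *\<^sub>v x s \<in> carrier_vec q" "C *\<^sub>v x' s \<in> carrier_vec q" "D *\<^sub>v u s \<in> carrier_vec q"
        using C D carr'[OF s] by auto
      ultimately have "C *\<^sub>v x s = C *\<^sub>v x' s" using add_vec_right_cancel by blast
      then show ?thesis using mult_diff_vec_eq_zero_iff[OF C carr'(1,2)[OF s]] by simp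
    qed
  qed (use carr' in auto)
  then show "F *\<^sub>v x t = F *\<^sub>v x' t" using mult_diff_vec_eq_zero_iff[OF F carr'(1,2)[OF t]] by simp
qed

theorem lemma2:
  fixes n m q r :: nat
    and A B C D F P Aob A21 Aunob Fob :: "real mat"
  assumes A: "A \<in> carrier_mat n n"
    and B: "B \<in> carrier_mat n m"
    and C: "C \<in> carrier_mat q n"
    and D: "D \<in> carrier_mat q m"
    and F: "F \<in> carrier_mat r n"
    and decomp: "observable_decomposition A F P Aob A21 Aunob Fob"
    and rank_CF: "mat_rank (C @\<^sub>r F) = mat_rank C"
  shows "(\<forall>ts :: real list. sampling_scheme ts \<longrightarrow>
            mat_rank (sampled_obs_matrix_ct Aob Fob ts) = n - unobs_dim A F \<longrightarrow>
            sample_based_functionally_observable_ct A B C D F ts)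
       \<and> (\<forall>ts :: nat list. sampling_scheme ts \<longrightarrow>
            mat_rank (sampled_obs_matrix_dt Aob Fob ts) = n - unobs_dim A F \<longrightarrow>
            sample_based_functionally_observable_dt (int (observability_index Aob Fob) - 2)
              A B C D F ts)"
proof -
  define d where "d = n - unobs_dim A F"
  obtain W where W: "W \<in> carrier_mat d n" and WA: "W * A = Aob * W" and FW: "F = Fob * W"
    and Aob: "Aob \<in> carrier_mat d d" and Fob: "Fob \<in> carrier_mat r d"
    using observable_decomposition_projection[OF A F decomp d_def] .
  show ?thesis
  proof (intro conjI allI impI)
    fix ts :: "real list"
    assume ts: "sampling_scheme ts"
      and "mat_rank (sampled_obs_matrix_ct Aob Fob ts) = n - unobs_dim A F"
    then have rank: "mat_rank (stack_rows d (map (\<lambda>t. Fob * mat_exp (t \<cdot>\<^sub>m Aob)) ts)) = d"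
      using Fob by (simp add: sampled_obs_matrix_ct_def d_def)
    \<comment> \<open>The inserted 1 keeps the horizon positive even if the only sample is at time
      0.\<close>
    define T where "T = Max (insert 1 (set ts))"
    have "1 \<le> T" unfolding T_def by (intro Max_ge) auto
    then have T: "0 < T" by simp
    have tsT: "set ts \<subseteq> {0..T}"
      using sampling_scheme_nonneg[OF ts] by (auto simp: T_def intro!: Max_ge)
    have "uniquely_reconstructible (trajectory_ct A B) C D F ts T"
    proof (rule uniquely_reconstructible_of_flow[OF C D F rank_CF W FW Fob _ rank tsT])
      show "mat_exp (t \<cdot>\<^sub>m Aob) \<in> carrier_mat d d" for t
        using Aob by (intro mat_exp_carrier) simp
      show "x t \<in> carrier_vec n \<and> u t \<in> carrier_vec m" if "trajectory_ct A B u x" "0 \<le> t" for u x t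
        using that A B by (simp add: trajectory_ct_def)
      show "W *\<^sub>v (x t - x' t) = mat_exp (t \<cdot>\<^sub>m Aob) *\<^sub>v (W *\<^sub>v (x 0 - x' 0))"
        if "trajectory_ct A B u x" "trajectory_ct A B u' x'" "\<forall>t\<in>{0..T}. u t = u' t" "t \<in> {0..T}"
        for u x u' x' t
        using projected_difference_ct[OF A B W Aob WA that] .
    qed (use T in simp)
    then show "sample_based_functionally_observable_ct A B C D F ts"
      using T unfolding sample_based_functionally_observable_ct_def by blast
  next
    fix ts :: "nat list"
    assume ts: "sampling_scheme ts"
      and "mat_rank (sampled_obs_matrix_dt Aob Fob ts) = n - unobs_dim A F"
    then have rank: "mat_rank (stack_rows d (map (\<lambda>t. Fob * Aob ^\<^sub>m t) ts)) = d"
      using Fob by (simp add: sampled_obs_matrix_dt_def d_def)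
    \<comment> \<open>Inserting the observability index \<nu> gives \<open>T \<ge> \<nu>\<close>,
      which exceeds the bound \<nu> - 2 taken in the integers.\<close>
    define T where "T = Max (insert (observability_index Aob Fob) (set ts))"
    have "observability_index Aob Fob \<le> T" by (simp add: T_def)
    then have T: "int (observability_index Aob Fob) - 2 < int T" by linarith
    have tsT: "set ts \<subseteq> {0..T}" by (auto simp: T_def intro!: Max_ge)
    have "uniquely_reconstructible (trajectory_dt A B) C D F ts T"
    proof (rule uniquely_reconstructible_of_flow[OF C D F rank_CF W FW Fob _ rank tsT])
      show "Aob ^\<^sub>m t \<in> carrier_mat d d" for t using Aob by simp
      show "x t \<in> carrier_vec n \<and> u t \<in> carrier_vec m" if "trajectory_dt A B u x" for u x t
        using that A B by (simp add: trajectory_dt_def)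
      show "W *\<^sub>v (x t - x' t) = Aob ^\<^sub>m t *\<^sub>v (W *\<^sub>v (x 0 - x' 0))"
        if "trajectory_dt A B u x" "trajectory_dt A B u' x'" "\<forall>t\<in>{0..T}. u t = u' t" "t \<in> {0..T}"
        for u x u' x' t
        using projected_difference_dt[OF A B W Aob WA that] .
    qed simp
    then show "sample_based_functionally_observable_dt (int (observability_index Aob Fob) - 2)
        A B C D F ts"
      using T unfolding sample_based_functionally_observable_dt_def by blast
  qed
qed

end
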